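(* For $n\geq 1$, let $G_{n+2}$ be the group with $n+2$ generators $y_1,\dots,y_{n+2}$ and the following defining relations: for $k=3,\dots,n$, every left-normalized commutator of length $k$ in the generators which consists of fewer than $k$ different symbols from $\{y_1,\dots,y_{n+2}\}$ is trivial. Then the group $G_{n+2}$ contains a free subgroup of rank $2$.
   Context: A left-normalized commutator of length $k$ in the generators is an element $[y_{i_1},y_{i_2},\dots,y_{i_k}]=[\dots[[y_{i_1},y_{i_2}],y_{i_3}],\dots,y_{i_k}]$ with $i_1,\dots,i_k\in\{1,\dots,n+2\}$, where $[g,h]=g^{-1}h^{-1}gh$. It consists of fewer than $k$ different symbols when $|\{i_1,\dots,i_k\}|<k$. For $n<3$ the set of relations is empty. *)

theory Defs
  imports "HOL-Algebra.Coset"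
begin

(* The letter (a, True) stands for the generator a, and (a, False) for its formal inverse. *)

type_synonym 'a word = "('a \<times> bool) list"

definition words :: "'a set \<Rightarrow> 'a word set"
  where "words S = lists (S \<times> UNIV)"

inductive free_eq :: "'a set \<Rightarrow> 'a word \<Rightarrow> 'a word \<Rightarrow> bool" for S
  where
    cancel: "\<lbrakk>u \<in> words S; v \<in> words S; a \<in> S\<rbrakk>
      \<Longrightarrow> free_eq S (u @ [(a, b), (a, \<not> b)] @ v) (u @ v)"
  | refl: "u \<in> words S \<Longrightarrow> free_eq S u u"
  | sym: "free_eq S u v \<Longrightarrow> free_eq S v u"
  | trans: "\<lbrakk>free_eq S u v; free_eq S v w\<rbrakk> \<Longrightarrow> free_eq S u w"

definition free_rel :: "'a set \<Rightarrow> ('a word \<times> 'a word) set"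
  where "free_rel S = {(u, v). free_eq S u v}"

definition free_group :: "'a set \<Rightarrow> 'a word set monoid"
  where "free_group S =
    \<lparr>carrier = words S // free_rel S,
     mult = (\<lambda>A B. \<Union>u\<in>A. \<Union>v\<in>B. free_rel S `` {u @ v}),
     one = free_rel S `` {[]}\<rparr>"

definition free_gen :: "'a set \<Rightarrow> 'a \<Rightarrow> 'a word set"
  where "free_gen S a = free_rel S `` {[(a, True)]}"

definition normal_closure :: "('a, 'b) monoid_scheme \<Rightarrow> 'a set \<Rightarrow> 'a set"
  where "normal_closure G R = \<Inter>{N. N \<lhd> G \<and> R \<subseteq> N}"

(* The relators R are elements of the free group on S. *)

definition presented_group :: "'a set \<Rightarrow> 'a word set set \<Rightarrow> 'a word set set monoid"
  where "presented_group S R = free_group S Mod normal_closure (free_group S) R"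

definition group_comm :: "('a, 'b) monoid_scheme \<Rightarrow> 'a \<Rightarrow> 'a \<Rightarrow> 'a"
  where "group_comm G g h = inv\<^bsub>G\<^esub> g \<otimes>\<^bsub>G\<^esub> inv\<^bsub>G\<^esub> h \<otimes>\<^bsub>G\<^esub> g \<otimes>\<^bsub>G\<^esub> h"

(* The value on the empty list is a dummy; left_comm G [x] = x. *)

fun left_comm :: "('a, 'b) monoid_scheme \<Rightarrow> 'a list \<Rightarrow> 'a"
  where
    "left_comm G [] = \<one>\<^bsub>G\<^esub>"
  | "left_comm G (x # xs) = foldl (group_comm G) x xs"

definition G_relators :: "nat \<Rightarrow> nat word set set"
  where "G_relators n =
    {left_comm (free_group {1..n + 2}) (map (free_gen {1..n + 2}) is) | is k.
      k \<in> {3..n} \<and> length is = k \<and> set is \<subseteq> {1..n + 2} \<and> card (set is) < k}"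

(* The parameter is n, not the number n + 2 of generators. *)

definition G_group :: "nat \<Rightarrow> nat word set set monoid"
  where "G_group n = presented_group {1..n + 2} (G_relators n)"

definition free_of_rank :: "('a, 'b) monoid_scheme \<Rightarrow> nat \<Rightarrow> bool"
  where "free_of_rank H r \<longleftrightarrow> H \<cong> free_group {1..r}"

lemma free_eq_words: "free_eq S u v \<Longrightarrow> u \<in> words S \<and> v \<in> words S"
  by (induction rule: free_eq.induct) (auto simp: words_def)

lemma equiv_free_rel: "equiv (words S) (free_rel S)"
  by (rule equivI)
    (auto simp: free_rel_def refl_on_def sym_def trans_def
      intro: free_eq.refl free_eq.sym free_eq.trans dest: free_eq_words)

lemma words_append [simp]: "u @ v \<in> words S \<longleftrightarrow> u \<in> words S \<and> v \<in> words S"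
  by (simp add: words_def)

lemma words_Nil [simp]: "[] \<in> words S"
  by (simp add: words_def)

lemma free_eq_context:
  assumes "free_eq S u v" "x \<in> words S" "y \<in> words S"
  shows "free_eq S (x @ u @ y) (x @ v @ y)"
  using assms
proof (induction rule: free_eq.induct)
  case (cancel u v a b)
  then show ?case
    using free_eq.cancel[of "x @ u" S "v @ y" a b] by simp
qed (auto intro: free_eq.refl free_eq.sym free_eq.trans)

lemma free_eq_append:
  assumes "free_eq S u u'" "free_eq S v v'"
  shows "free_eq S (u @ v) (u' @ v')"
proof -
  have "free_eq S (u @ v) (u' @ v)"
    using free_eq_context[of S u u' "[]" v] assms free_eq_words by fastforce
  moreover have "free_eq S (u' @ v) (u' @ v')"
    using free_eq_context[of S v v' u' "[]"] assms free_eq_words by fastforce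
  ultimately show ?thesis by (rule free_eq.trans)
qed

abbreviation free_class :: "'a set \<Rightarrow> 'a word \<Rightarrow> 'a word set"
  where "free_class S u \<equiv> free_rel S `` {u}"

lemma free_class_eq_iff:
  assumes "u \<in> words S" "v \<in> words S"
  shows "free_class S u = free_class S v \<longleftrightarrow> free_eq S u v"
  using eq_equiv_class_iff[OF equiv_free_rel assms] by (simp add: free_rel_def)

lemma free_group_mult:
  assumes "u \<in> words S" "v \<in> words S"
  shows "free_class S u \<otimes>\<^bsub>free_group S\<^esub> free_class S v = free_class S (u @ v)"
proof -
  have "congruent2 (free_rel S) (free_rel S) (\<lambda>u v. free_class S (u @ v))"
    unfolding congruent2_def
    by (auto simp: free_rel_def
        intro: free_eq.trans free_eq_append free_eq_append[THEN free_eq.sym])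
  from UN_equiv_class2[OF equiv_free_rel equiv_free_rel this assms] show ?thesis
    by (simp add: free_group_def)
qed

lemma free_group_carrierE:
  assumes "A \<in> carrier (free_group S)"
  obtains u where "u \<in> words S" "A = free_class S u"
  using assms by (auto simp: free_group_def elim!: quotientE)

lemma free_class_carrier:
  "u \<in> words S \<Longrightarrow> free_class S u \<in> carrier (free_group S)"
  by (auto simp: free_group_def intro: quotientI)

lemma free_gen_carrier: "a \<in> S \<Longrightarrow> free_gen S a \<in> carrier (free_group S)"
  unfolding free_gen_def by (rule free_class_carrier) (auto simp: words_def)

lemma free_group_one: "\<one>\<^bsub>free_group S\<^esub> = free_class S []"
  by (simp add: free_group_def)

definition word_inv :: "'a word \<Rightarrow> 'a word"
  where "word_inv w = rev (map (\<lambda>(a, b). (a, \<not> b)) w)"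

lemma word_inv_words: "w \<in> words S \<Longrightarrow> word_inv w \<in> words S"
  by (auto simp: word_inv_def words_def)

lemma free_eq_word_inv:
  "w \<in> words S \<Longrightarrow> free_eq S (word_inv w @ w) []"
proof (induction w)
  case Nil
  then show ?case by (simp add: word_inv_def free_eq.refl)
next
  case (Cons x w)
  obtain a b where x: "x = (a, b)" by force
  from Cons.prems have a: "a \<in> S" and w: "w \<in> words S"
    by (auto simp: words_def x)
  have "free_eq S (word_inv w @ [(a, \<not> b), (a, \<not> \<not> b)] @ w) (word_inv w @ w)"
    using a w word_inv_words by (intro free_eq.cancel) auto
  then have "free_eq S (word_inv (x # w) @ x # w) (word_inv w @ w)"
    by (simp add: word_inv_def x)
  from this Cons.IH[OF w] show ?case by (rule free_eq.trans)
qed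

lemma group_free_group: "group (free_group S)"
proof (rule groupI)
  fix A B assume "A \<in> carrier (free_group S)" "B \<in> carrier (free_group S)"
  then show "A \<otimes>\<^bsub>free_group S\<^esub> B \<in> carrier (free_group S)"
    by (elim free_group_carrierE) (simp add: free_group_mult free_class_carrier)
next
  show "\<one>\<^bsub>free_group S\<^esub> \<in> carrier (free_group S)"
    by (simp add: free_group_one free_class_carrier)
next
  fix A B C
  assume "A \<in> carrier (free_group S)" "B \<in> carrier (free_group S)" "C \<in> carrier (free_group S)"
  then show "A \<otimes>\<^bsub>free_group S\<^esub> B \<otimes>\<^bsub>free_group S\<^esub> C =
      A \<otimes>\<^bsub>free_group S\<^esub> (B \<otimes>\<^bsub>free_group S\<^esub> C)"
    by (elim free_group_carrierE) (simp add: free_group_mult)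
next
  fix A assume "A \<in> carrier (free_group S)"
  then show "\<one>\<^bsub>free_group S\<^esub> \<otimes>\<^bsub>free_group S\<^esub> A = A"
    by (elim free_group_carrierE) (simp add: free_group_one free_group_mult)
next
  fix A assume "A \<in> carrier (free_group S)"
  then obtain u where u: "u \<in> words S" "A = free_class S u"
    by (rule free_group_carrierE)
  have "free_class S (word_inv u) \<otimes>\<^bsub>free_group S\<^esub> A = \<one>\<^bsub>free_group S\<^esub>"
    using u by (simp add: free_group_mult word_inv_words free_group_one
        free_class_eq_iff free_eq_word_inv)
  then show "\<exists>B\<in>carrier (free_group S). B \<otimes>\<^bsub>free_group S\<^esub> A = \<one>\<^bsub>free_group S\<^esub>"
    using u free_class_carrier word_inv_words by blast
qed

lemma normal_normal_closure:
  assumes "group G" "R \<subseteq> carrier G"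
  shows "normal_closure G R \<lhd> G"
proof -
  interpret group G by fact
  have top: "carrier G \<lhd> G"
    by (rule normal_invI) (auto intro: subgroup_self)
  show ?thesis
  proof (rule normal_invI)
    show "subgroup (normal_closure G R) G"
      unfolding normal_closure_def
      by (rule subgroups_Inter) (use top assms in \<open>auto simp: normal_def\<close>)
    show "\<And>x h. x \<in> carrier G \<Longrightarrow> h \<in> normal_closure G R \<Longrightarrow>
        x \<otimes>\<^bsub>G\<^esub> h \<otimes>\<^bsub>G\<^esub> inv\<^bsub>G\<^esub> x \<in> normal_closure G R"
      by (auto simp: normal_closure_def intro: normal.inv_op_closed2)
  qed
qed

lemma group_presented_group:
  "R \<subseteq> carrier (free_group S) \<Longrightarrow> group (presented_group S R)"
  unfolding presented_group_def
  by (intro normal.factorgroup_is_group normal_normal_closure group_free_group)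

lemma left_comm_closed:
  assumes "group G" "set xs \<subseteq> carrier G"
  shows "left_comm G xs \<in> carrier G"
proof -
  interpret group G by fact
  have "foldl (group_comm G) x ys \<in> carrier G"
    if "x \<in> carrier G" "set ys \<subseteq> carrier G" for x ys
    using that by (induction ys arbitrary: x) (auto simp: group_comm_def)
  with assms(2) show ?thesis by (cases xs) auto
qed

lemma group_G_group: "group (G_group n)"
  unfolding G_group_def
proof (rule group_presented_group)
  show "G_relators n \<subseteq> carrier (free_group {1..n + 2})"
    unfolding G_relators_def
    by (safe, rule left_comm_closed[OF group_free_group]) (auto intro!: free_gen_carrier)
qed

end

theory Submission
  imports Defs "HOL-Algebra.Bij"
begin

text \<open>
  Let \<open>m = n + 2\<close> and number the coordinates of \<open>\<int>\<^sup>m\<close> cyclically modulo \<open>m\<close>. Send the generator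
  \<open>y\<^sub>i\<close> to the transvection \<open>I + 3 E\<^bsub>i,i+1\<^esub>\<close>. By the Steinberg relations, a left-normalized
  commutator of these transvections in which at least one generator is absent is either the identity or
  a transvection \<open>I + a E\<^bsub>p,p+k\<^esub>\<close> whose support is an arc \<open>p, \<dots>, p + k - 1\<close> of the cycle, with
  every generator of the arc used exactly once (\<open>left_comm_cyc_arc\<close>). So a commutator of
  length \<open>k \<le> n\<close> with a repeated symbol, which is bound to miss a generator, is the
  identity: the assignment kills all relators.

  Nevertheless the image is large, because the cycle closes up. The commutator
  \<open>[y\<^sub>1, \<dots>, y\<^bsub>m-1\<^esub>]\<close> goes to \<open>I + 3\<^bsup>m-1\<^esup> E\<^bsub>1,0\<^esub>\<close> and \<open>y\<^sub>m\<close> goes to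
  \<open>I + 3 E\<^bsub>0,1\<^esub>\<close>; as all the entries have absolute value at least 3, playing ping-pong with the
  vector \<open>(1, \<dots>, 1)\<close> shows that these two matrices satisfy no nontrivial relation
  (\<open>word_val_transvections_neq_one\<close>). The subgroup generated by \<open>[y\<^sub>1, \<dots>, y\<^bsub>m-1\<^esub>]\<close>
  and \<open>y\<^sub>m\<close> is therefore free of rank 2. It is enough to argue in the free group on the
  \<open>y\<^sub>i\<close>: a word in the two elements that lies in the normal closure of the
  relators is killed by the linear representation, hence is freely trivial
  (\<open>free_subgroup_of_presented_group\<close>).
\<close>

section \<open>Evaluating words in a group\<close>

definition letter_val :: "('b, 'c) monoid_scheme \<Rightarrow> ('a \<Rightarrow> 'b) \<Rightarrow> 'a \<times> bool \<Rightarrow> 'b"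
  where "letter_val K f x = (if snd x then f (fst x) else inv\<^bsub>K\<^esub> f (fst x))"

definition word_val :: "('b, 'c) monoid_scheme \<Rightarrow> ('a \<Rightarrow> 'b) \<Rightarrow> 'a word \<Rightarrow> 'b"
  where "word_val K f w = foldr (\<lambda>x g. letter_val K f x \<otimes>\<^bsub>K\<^esub> g) w \<one>\<^bsub>K\<^esub>"

lemma word_val_Nil [simp]: "word_val K f [] = \<one>\<^bsub>K\<^esub>"
  by (simp add: word_val_def)

lemma word_val_Cons [simp]:
  "word_val K f (x # w) = letter_val K f x \<otimes>\<^bsub>K\<^esub> word_val K f w"
  by (simp add: word_val_def)

lemma words_Cons [simp]: "x # w \<in> words S \<longleftrightarrow> fst x \<in> S \<and> w \<in> words S"
  by (cases x) (auto simp: words_def)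

context group
begin

lemma letter_val_closed:
  "f \<in> S \<rightarrow> carrier G \<Longrightarrow> fst x \<in> S \<Longrightarrow> letter_val G f x \<in> carrier G"
  by (auto simp: letter_val_def)

lemma word_val_closed:
  "f \<in> S \<rightarrow> carrier G \<Longrightarrow> w \<in> words S \<Longrightarrow> word_val G f w \<in> carrier G"
  by (induction w) (auto simp: letter_val_closed)

lemma word_val_append:
  assumes "f \<in> S \<rightarrow> carrier G" "v \<in> words S" "w \<in> words S"
  shows "word_val G f (v @ w) = word_val G f v \<otimes> word_val G f w"
  using assms
  by (induction v) (simp_all add: word_val_closed letter_val_closed m_assoc)

lemma word_val_free_eq:
  assumes f: "f \<in> S \<rightarrow> carrier G" and "free_eq S u v"
  shows "word_val G f u = word_val G f v"
  using assms(2)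
proof (induction rule: free_eq.induct)
  case (cancel u v a b)
  have fa: "f a \<in> carrier G"
    using f cancel.hyps by auto
  have w: "[(a, b), (a, \<not> b)] \<in> words S"
    using cancel.hyps by simp
  have "word_val G f [(a, b), (a, \<not> b)] = \<one>"
    using fa by (simp add: letter_val_def)
  then show ?case
    using f cancel.hyps w fa
    by (simp only: word_val_append[OF f] words_append word_val_closed[OF f] l_one)
qed auto

end

text \<open>The choice of a representative is harmless by \<open>word_val_free_eq\<close>; this is
  the homomorphism given by the universal property of the free group.\<close>

definition free_lift :: "('b, 'c) monoid_scheme \<Rightarrow> ('a \<Rightarrow> 'b) \<Rightarrow> 'a word set \<Rightarrow> 'b"
  where "free_lift K f A = word_val K f (SOME w. w \<in> A)"

context group
begin

lemma free_lift_class: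
  assumes "f \<in> S \<rightarrow> carrier G" "w \<in> words S"
  shows "free_lift G f (free_class S w) = word_val G f w"
proof -
  have "w \<in> free_class S w"
    using assms by (simp add: free_rel_def free_eq.refl)
  then have "(SOME v. v \<in> free_class S w) \<in> free_class S w"
    by (metis someI)
  then have "free_eq S w (SOME v. v \<in> free_class S w)"
    by (simp add: free_rel_def)
  then show ?thesis
    using word_val_free_eq[OF assms(1)] by (simp add: free_lift_def)
qed

lemma free_lift_hom:
  assumes "f \<in> S \<rightarrow> carrier G"
  shows "free_lift G f \<in> hom (free_group S) G"
  using assms
  by (intro homI; elim free_group_carrierE)
    (simp_all add: free_lift_class free_group_mult word_val_closed word_val_append)

lemma free_lift_gen:
  assumes "f \<in> S \<rightarrow> carrier G" "a \<in> S"
  shows "free_lift G f (free_gen S a) = f a"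
proof -
  have "f a \<in> carrier G"
    using assms by auto
  then show ?thesis
    using assms by (simp add: free_gen_def free_lift_class letter_val_def)
qed

end

section \<open>Homomorphisms, commutators and free subgroups\<close>

context group_hom
begin

lemma hom_word_val:
  assumes "f \<in> S \<rightarrow> carrier G" "w \<in> words S"
  shows "h (word_val G f w) = word_val H (h \<circ> f) w"
  using assms(2)
proof (induction w)
  case (Cons x w)
  have "f (fst x) \<in> carrier G"
    using assms(1) Cons.prems by auto
  then have "h (letter_val G f x) = letter_val H (h \<circ> f) x"
    by (simp add: letter_val_def)
  then show ?case
    using Cons assms(1) by (simp add: G.letter_val_closed G.word_val_closed o_def)
qed simp

lemma hom_left_comm:
  assumes "set xs \<subseteq> carrier G"
  shows "h (left_comm G xs) = left_comm H (map h xs)"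
proof -
  have "h (foldl (group_comm G) x ys) = foldl (group_comm H) (h x) (map h ys)"
    if "x \<in> carrier G" "set ys \<subseteq> carrier G" for x ys
    using that by (induction ys arbitrary: x) (auto simp: group_comm_def)
  with assms show ?thesis
    by (cases xs) auto
qed

end

lemma left_comm_snoc:
  "xs \<noteq> [] \<Longrightarrow> left_comm G (xs @ [x]) = group_comm G (left_comm G xs) x"
  by (cases xs) auto

lemma (in group_hom) subgroup_iso_of_inj:
  assumes "\<And>x. x \<in> carrier G \<Longrightarrow> h x = \<one>\<^bsub>H\<^esub> \<Longrightarrow> x = \<one>"
  shows "subgroup (h ` carrier G) H" "H\<lparr>carrier := h ` carrier G\<rparr> \<cong> G"
proof -
  show "subgroup (h ` carrier G) H"
    by (rule img_is_subgroup)
  have "inj_on h (carrier G)"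
    using assms inj_on_one_iff by blast
  then have "h \<in> iso G (H\<lparr>carrier := h ` carrier G\<rparr>)"
    by (auto simp: iso_def hom_def bij_betw_def)
  then show "H\<lparr>carrier := h ` carrier G\<rparr> \<cong> G"
    using G.iso_sym is_isoI by blast
qed

text \<open>A representation \<open>\<theta>\<close> of the free group that kills the relators
  certifies freeness in the presented group: the elements \<open>g i\<close> generate a free subgroup there as soon
  as their images under \<open>\<theta>\<close> satisfy no nontrivial relation. Indeed, a word in the
  \<open>g i\<close> that becomes trivial there lies in the normal closure of the relators, which is
  contained in the kernel of \<open>\<theta>\<close>.\<close>

lemma free_subgroup_of_presented_group:
  assumes K: "group K" and \<theta>: "\<theta> \<in> hom (free_group S) K"
    and R: "R \<subseteq> carrier (free_group S)" "\<And>r. r \<in> R \<Longrightarrow> \<theta> r = \<one>\<^bsub>K\<^esub>"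
    and g: "g \<in> I \<rightarrow> carrier (free_group S)"
    and free: "\<And>w. w \<in> words I \<Longrightarrow> word_val K (\<theta> \<circ> g) w = \<one>\<^bsub>K\<^esub> \<Longrightarrow> free_eq I w []"
  shows "\<exists>H. subgroup H (presented_group S R)
    \<and> (presented_group S R)\<lparr>carrier := H\<rparr> \<cong> free_group I"
proof -
  interpret F: group "free_group S"
    by (rule group_free_group)
  define N where "N = normal_closure (free_group S) R"
  interpret N: normal N "free_group S"
    unfolding N_def by (rule normal_normal_closure[OF group_free_group R(1)])
  interpret \<theta>: group_hom "free_group S" K \<theta>
    using K \<theta> by (simp add: group_hom_def group_hom_axioms_def group_free_group)
  have "R \<subseteq> kernel (free_group S) K \<theta>"
    using R by (auto simp: kernel_def)
  then have N_kernel: "N \<subseteq> kernel (free_group S) K \<theta>"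
    unfolding N_def normal_closure_def using \<theta>.normal_kernel by blast
  define Q where "Q = presented_group S R"
  have Q: "Q = free_group S Mod N"
    by (simp add: Q_def presented_group_def N_def)
  define \<psi> where "\<psi> = (\<lambda>x. N #>\<^bsub>free_group S\<^esub> x) \<circ> free_lift (free_group S) g"
  have "\<psi> \<in> hom (free_group I) Q"
    unfolding \<psi>_def Q using F.free_lift_hom[OF g] N.r_coset_hom_Mod
    by (rule Group.hom_compose)
  then interpret \<psi>: group_hom "free_group I" Q \<psi>
    using N.factorgroup_is_group
    by (simp add: group_hom_def group_hom_axioms_def group_free_group Q)
  have "A = \<one>\<^bsub>free_group I\<^esub>" if A: "A \<in> carrier (free_group I)" "\<psi> A = \<one>\<^bsub>Q\<^esub>" for A
  proof -
    obtain w where w: "w \<in> words I" "A = free_class I w"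
      using A(1) by (rule free_group_carrierE)
    let ?x = "word_val (free_group S) g w"
    have x: "?x \<in> carrier (free_group S)"
      using g w(1) by (rule F.word_val_closed)
    have "N #>\<^bsub>free_group S\<^esub> ?x = N"
      using A(2) w by (simp add: \<psi>_def Q FactGroup_def F.free_lift_class[OF g])
    then have "?x \<in> N"
      using x N.subgroup_axioms by (rule F.coset_join1)
    then have "\<theta> ?x = \<one>\<^bsub>K\<^esub>"
      using N_kernel by (auto simp: kernel_def)
    then have "free_eq I w []"
      using free w(1) \<theta>.hom_word_val[OF g w(1)] by simp
    then show ?thesis
      using w by (simp add: free_group_one free_class_eq_iff)
  qed
  from \<psi>.subgroup_iso_of_inj[OF this] show ?thesis
    unfolding Q_def by blast
qed

section \<open>Reduced words\<close>

definition reduced :: "'a word \<Rightarrow> bool"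
  where "reduced w = successively (\<lambda>x y. y \<noteq> (fst x, \<not> snd x)) w"

lemma reduced_Cons:
  "reduced (x # w) \<longleftrightarrow> w = [] \<or> (hd w \<noteq> (fst x, \<not> snd x) \<and> reduced w)"
  by (cases w) (auto simp: reduced_def)

lemma free_eq_reduced:
  "w \<in> words S \<Longrightarrow> \<exists>r. reduced r \<and> free_eq S w r"
proof (induction w)
  case Nil
  have "reduced ([] :: 'a word)"
    by (simp add: reduced_def)
  then show ?case
    using free_eq.refl words_Nil by blast
next
  case (Cons x w)
  then obtain r where r: "reduced r" "free_eq S w r"
    by auto
  have x: "[x] \<in> words S" and rS: "r \<in> words S"
    using Cons.prems r(2) free_eq_words by auto
  have xr: "free_eq S (x # w) (x # r)"
    using free_eq_append[OF free_eq.refl[OF x] r(2)] by simp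
  show ?case
  proof (cases "reduced (x # r)")
    case True
    then show ?thesis
      using xr by blast
  next
    case False
    then obtain r' where r': "r = (fst x, \<not> snd x) # r'"
      using r(1) by (cases r) (auto simp: reduced_Cons)
    have "free_eq S ([] @ [(fst x, snd x), (fst x, \<not> snd x)] @ r') ([] @ r')"
      using x rS r' by (intro free_eq.cancel) auto
    then have "free_eq S (x # w) r'"
      using xr r' by (auto intro: free_eq.trans)
    moreover have "reduced r'"
      using r(1) r' by (auto simp: reduced_Cons) (simp add: reduced_def)
    ultimately show ?thesis
      by blast
  qed
qed

section \<open>Transvections\<close>

text \<open>Integer matrices whose size depends on \<open>n\<close> are realized as permutations of
  the single set of all integer sequences, so that one target group serves every
  \<open>n\<close>; only the coordinates below \<open>n + 2\<close> are ever changed.\<close>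

abbreviation seq_perms :: "((nat \<Rightarrow> int) \<Rightarrow> nat \<Rightarrow> int) monoid"
  where "seq_perms \<equiv> BijGroup UNIV"

definition transvection :: "nat \<Rightarrow> nat \<Rightarrow> int \<Rightarrow> (nat \<Rightarrow> int) \<Rightarrow> nat \<Rightarrow> int"
  where "transvection p q a z = z(p := z p + a * z q)"

interpretation P: group seq_perms
  by (rule group_BijGroup)

lemma carrier_seq_perms: "f \<in> carrier seq_perms \<longleftrightarrow> bij f"
  by (simp add: BijGroup_def Bij_def)

lemma mult_seq_perms: "bij f \<Longrightarrow> bij g \<Longrightarrow> f \<otimes>\<^bsub>seq_perms\<^esub> g = f \<circ> g"
  by (simp add: BijGroup_def Bij_def compose_def fun_eq_iff)

lemma one_seq_perms: "\<one>\<^bsub>seq_perms\<^esub> = id"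
  by (simp add: BijGroup_def fun_eq_iff)

lemma transvection_comp_minus:
  "p \<noteq> q \<Longrightarrow> transvection p q a \<circ> transvection p q (- a) = id"
  by (auto simp: transvection_def fun_eq_iff)

lemma bij_transvection:
  assumes "p \<noteq> q"
  shows "bij (transvection p q a)"
  using transvection_comp_minus[OF assms, of a] transvection_comp_minus[OF assms, of "- a"]
  by (intro o_bij[where g = "transvection p q (- a)"]) simp_all

lemma transvection_closed: "p \<noteq> q \<Longrightarrow> transvection p q a \<in> carrier seq_perms"
  by (simp add: carrier_seq_perms bij_transvection)

lemma inv_transvection:
  assumes "p \<noteq> q"
  shows "inv\<^bsub>seq_perms\<^esub> transvection p q a = transvection p q (- a)"
  using transvection_comp_minus[OF assms, of "- a"] assms
  by (intro P.inv_equality)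
    (simp_all add: transvection_closed mult_seq_perms bij_transvection one_seq_perms)

lemma comm_transvection_eq:
  assumes "p \<noteq> q" "r \<noteq> s"
  shows "group_comm seq_perms (transvection p q a) (transvection r s b)
    = transvection p q (- a) \<circ> transvection r s (- b) \<circ> transvection p q a \<circ> transvection r s b"
  using assms
  by (simp add: group_comm_def inv_transvection mult_seq_perms bij_transvection bij_comp)

text \<open>The next three lemmas are the Steinberg relations. In matrix form, \<open>A = a E\<^bsub>p,q\<^esub>\<close> and
  \<open>B = b E\<^bsub>r,s\<^esub>\<close> satisfy \<open>A\<^sup>2 = B\<^sup>2 = 0\<close>, and if at most one of \<open>AB\<close> and \<open>BA\<close> is nonzero, then the
  commutator of \<open>I + A\<close> and \<open>I + B\<close> is \<open>I + AB - BA\<close>.\<close>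

lemma comm_transvection_commuting:
  assumes "p \<noteq> q" "r \<noteq> s" "q \<noteq> r" "p \<noteq> s"
  shows "group_comm seq_perms (transvection p q a) (transvection r s b) = \<one>\<^bsub>seq_perms\<^esub>"
  using assms
  by (auto simp: comm_transvection_eq one_seq_perms transvection_def fun_eq_iff algebra_simps)

lemma comm_transvection_right:
  assumes "p \<noteq> q" "q \<noteq> s" "p \<noteq> s"
  shows "group_comm seq_perms (transvection p q a) (transvection q s b)
    = transvection p s (a * b)"
  using assms
  by (auto simp: comm_transvection_eq transvection_def fun_eq_iff algebra_simps)

lemma comm_transvection_left:
  assumes "p \<noteq> q" "r \<noteq> p" "r \<noteq> q"
  shows "group_comm seq_perms (transvection p q a) (transvection r p b)
    = transvection r q (- (a * b))"
  using assms
  by (auto simp: comm_transvection_eq transvection_def fun_eq_iff algebra_simps)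

section \<open>Two opposite transvections generate a free group\<close>

text \<open>The table of ping-pong for \<open>transvection p q a\<close>. The sign condition separates the table
  of a transvection from that of its inverse; without it, a transvection
  need not map its own table into itself.\<close>

definition table :: "nat \<Rightarrow> nat \<Rightarrow> int \<Rightarrow> (nat \<Rightarrow> int) set"
  where "table p q a = {z. \<bar>z q\<bar> < \<bar>z p\<bar> \<and> 0 < z p * (a * z q)}"

lemma transvection_into_table:
  assumes "p \<noteq> q" "3 \<le> \<bar>a\<bar>" "\<bar>z p\<bar> \<le> \<bar>z q\<bar>" "z q \<noteq> 0"
  shows "transvection p q a z \<in> table p q a"
proof -
  have *: "3 * \<bar>z q\<bar> \<le> \<bar>a * z q\<bar>"
    using assms by (simp add: abs_mult mult_right_mono)
  have "\<bar>z q\<bar> < \<bar>z p + a * z q\<bar>"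
    using * assms by linarith
  moreover have "0 < z p + a * z q \<and> 0 < a * z q \<or> z p + a * z q < 0 \<and> a * z q < 0"
    using * assms by linarith
  then have "0 < (z p + a * z q) * (a * z q)"
    by (auto simp: zero_less_mult_iff)
  ultimately show ?thesis
    using assms(1) by (simp add: table_def transvection_def)
qed

lemma transvection_table:
  assumes "p \<noteq> q" "z \<in> table p q a"
  shows "transvection p q a z \<in> table p q a"
proof -
  have sgn: "0 < z p \<and> 0 < a * z q \<or> z p < 0 \<and> a * z q < 0"
    and less: "\<bar>z q\<bar> < \<bar>z p\<bar>"
    using assms(2) unfolding table_def zero_less_mult_iff by auto
  have "\<bar>z q\<bar> < \<bar>z p + a * z q\<bar>"
    using sgn less by linarith
  moreover have "0 < z p + a * z q \<and> 0 < a * z q \<or> z p + a * z q < 0 \<and> a * z q < 0"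
    using sgn by linarith
  then have "0 < (z p + a * z q) * (a * z q)"
    by (auto simp: zero_less_mult_iff)
  ultimately show ?thesis
    using assms(1) by (simp add: table_def transvection_def)
qed

lemma table_le_opposite: "z \<in> table q p b \<Longrightarrow> \<bar>z p\<bar> \<le> \<bar>z q\<bar> \<and> z q \<noteq> 0"
  by (auto simp: table_def)

lemma letter_val_transvection:
  assumes "f (fst x) = transvection p q a" "p \<noteq> q"
  shows "letter_val seq_perms f x = transvection p q (if snd x then a else - a)"
  using assms by (simp add: letter_val_def inv_transvection)

text \<open>Starting from the constant sequence 1, which lies in no table, a reduced word moves it into the
  table of its leftmost letter. Entries of absolute value 2 would not suffice for this choice of a
  starting point, as the first step needs \<open>\<bar>1 + a\<bar> > 1\<close>.\<close>

lemma word_val_transvections_in_table: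
  assumes f: "f 1 = transvection p q a" "f 2 = transvection q p b"
    and pq: "p \<noteq> q" and a: "3 \<le> \<bar>a\<bar>" and b: "3 \<le> \<bar>b\<bar>"
    and w: "w \<in> words {1..2::nat}" "reduced w" "w \<noteq> []"
  shows "word_val seq_perms f w (\<lambda>_. 1)
    \<in> (if fst (hd w) = 1 then table p q (if snd (hd w) then a else - a)
       else table q p (if snd (hd w) then b else - b))"
  using w
proof (induction w)
  case (Cons x w)
  have f_closed: "f \<in> {1..2} \<rightarrow> carrier seq_perms"
  proof
    fix i :: nat assume "i \<in> {1..2}"
    then have "i = 1 \<or> i = 2" by auto
    then show "f i \<in> carrier seq_perms"
      using f pq by (auto simp: transvection_closed)
  qed
  have w: "w \<in> words {1..2}" and fst_x: "fst x = 1 \<or> fst x = 2"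
    using Cons.prems(1) by auto
  let ?z = "word_val seq_perms f w (\<lambda>_. 1)"
  have val: "word_val seq_perms f (x # w) (\<lambda>_. 1) = letter_val seq_perms f x ?z"
    using P.letter_val_closed[OF f_closed, of x] P.word_val_closed[OF f_closed w] Cons.prems(1)
    by (simp add: carrier_seq_perms mult_seq_perms)
  have start: "w = [] \<Longrightarrow> ?z = (\<lambda>_. 1)"
    by (simp add: one_seq_perms)
  have IH: "?z \<in> (if fst (hd w) = 1 then table p q (if snd (hd w) then a else - a)
       else table q p (if snd (hd w) then b else - b))" if "w \<noteq> []"
    using Cons.IH Cons.prems(2) w that by (auto simp: reduced_Cons)
  have same: "snd (hd w) = snd x" if "w \<noteq> []" "fst (hd w) = fst x"
    using that Cons.prems(2) by (cases "hd w") (auto simp: reduced_Cons)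
  have hd_w: "fst (hd w) = 1 \<or> fst (hd w) = 2" if "w \<noteq> []"
    using w that by (cases w) auto
  from fst_x show ?case
  proof
    assume x: "fst x = 1"
    let ?a = "if snd x then a else - a"
    have "transvection p q ?a ?z \<in> table p q ?a"
    proof (cases "w \<noteq> [] \<and> fst (hd w) = 1")
      case True
      then have "?z \<in> table p q ?a"
        using IH same x by auto
      then show ?thesis
        by (rule transvection_table[OF pq])
    next
      case False
      then have "\<bar>?z p\<bar> \<le> \<bar>?z q\<bar> \<and> ?z q \<noteq> 0"
        using start IH table_le_opposite[of ?z q p] by (cases "w = []") auto
      then show ?thesis
        using pq a by (intro transvection_into_table) auto
    qed
    then show ?thesis
      using letter_val_transvection[of f x p q a] f x pq val by simp
  next
    assume x: "fst x = 2"
    let ?b = "if snd x then b else - b"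
    have "transvection q p ?b ?z \<in> table q p ?b"
    proof (cases "w \<noteq> [] \<and> fst (hd w) = 2")
      case True
      then have "?z \<in> table q p ?b"
        using IH same x by auto
      then show ?thesis
        by (rule transvection_table[OF pq[symmetric]])
    next
      case False
      then have "\<bar>?z q\<bar> \<le> \<bar>?z p\<bar> \<and> ?z p \<noteq> 0"
        using start IH hd_w table_le_opposite[of ?z p q] by (cases "w = []") auto
      then show ?thesis
        using pq b by (intro transvection_into_table) auto
    qed
    then show ?thesis
      using letter_val_transvection[of f x q p b] f x pq val by simp
  qed
qed simp

lemma word_val_transvections_neq_one:
  assumes "f 1 = transvection p q a" "f 2 = transvection q p b"
    and "p \<noteq> q" "3 \<le> \<bar>a\<bar>" "3 \<le> \<bar>b\<bar>"
    and "w \<in> words {1..2::nat}" "reduced w" "w \<noteq> []"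
  shows "word_val seq_perms f w \<noteq> \<one>\<^bsub>seq_perms\<^esub>"
  using word_val_transvections_in_table[OF assms]
  by (auto simp: one_seq_perms table_def split: if_splits)

lemma transvections_free:
  assumes f: "f 1 = transvection p q a" "f 2 = transvection q p b"
    and pq: "p \<noteq> q" and ab: "3 \<le> \<bar>a\<bar>" "3 \<le> \<bar>b\<bar>"
    and w: "w \<in> words {1..2::nat}" "word_val seq_perms f w = \<one>\<^bsub>seq_perms\<^esub>"
  shows "free_eq {1..2} w []"
proof -
  obtain r where r: "reduced r" "free_eq {1..2} w r"
    using free_eq_reduced[OF w(1)] by blast
  have "f i \<in> carrier seq_perms" if "i \<in> {1..2}" for i
  proof -
    have "i = 1 \<or> i = 2" using that by auto
    then show ?thesis
      using f pq by (auto simp: transvection_closed)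
  qed
  then have "word_val seq_perms f r = \<one>\<^bsub>seq_perms\<^esub>"
    using P.word_val_free_eq[of f "{1..2}" w r] r(2) w(2) by auto
  then have "r = []"
    using word_val_transvections_neq_one[OF f pq ab] r free_eq_words by blast
  then show ?thesis
    using r(2) by simp
qed

section \<open>Commutators of cyclically arranged transvections\<close>

text \<open>The image of the \<open>i\<close>-th generator: the matrix \<open>I + 3 E\<^bsub>i,i+1\<^esub>\<close> with indices modulo \<open>m\<close>.\<close>

definition cyc :: "nat \<Rightarrow> nat \<Rightarrow> (nat \<Rightarrow> int) \<Rightarrow> nat \<Rightarrow> int"
  where "cyc m i = transvection (i mod m) (Suc i mod m) 3"

definition arc :: "nat \<Rightarrow> nat \<Rightarrow> nat \<Rightarrow> nat set"
  where "arc m p k = (\<lambda>t. (p + t) mod m) ` {..<k}"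

lemma mod_add_inj:
  assumes "(p + s) mod m = (p + t) mod m" "s < m" "t < (m :: nat)"
  shows "s = t"
proof -
  have "int m dvd int s - int t"
    using assms(1) by (simp add: mod_eq_dvd_iff zmod_int flip: of_nat_eq_iff[where 'a = int])
  then show ?thesis
    using assms(2,3) dvd_imp_le_int[of "int s - int t" "int m"] by fastforce
qed

lemma card_arc: "k \<le> m \<Longrightarrow> card (arc m p k) = k"
  unfolding arc_def by (subst card_image) (auto intro!: inj_onI dest: mod_add_inj)

lemma arc_Suc_right: "arc m p (Suc k) = insert ((p + k) mod m) (arc m p k)"
  by (simp add: arc_def lessThan_Suc)

lemma arc_Suc_left: "arc m p (Suc k) = insert (p mod m) (arc m (Suc p) k)"
  by (simp add: arc_def lessThan_Suc_eq_insert_0 image_image)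

lemma arc_cong: "p mod m = q mod m \<Longrightarrow> arc m p k = arc m q k"
  unfolding arc_def by (metis mod_add_left_eq)

lemma mod_neq_mod_add: "0 < k \<Longrightarrow> k < m \<Longrightarrow> p mod m \<noteq> (p + k) mod (m :: nat)"
  using mod_add_inj[of p 0 m k] by auto

lemma mod_neq_Suc_mod: "2 \<le> m \<Longrightarrow> i mod m \<noteq> Suc i mod (m :: nat)"
  using mod_neq_mod_add[of 1 m i] by simp

lemma cyc_closed: "2 \<le> m \<Longrightarrow> cyc m i \<in> carrier seq_perms"
  unfolding cyc_def by (intro transvection_closed mod_neq_Suc_mod)

lemma group_comm_one_left:
  assumes "group G" "g \<in> carrier G"
  shows "group_comm G \<one>\<^bsub>G\<^esub> g = \<one>\<^bsub>G\<^esub>"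
proof -
  interpret group G by fact
  show ?thesis using assms by (simp add: group_comm_def)
qed

text \<open>The commutator of a transvection supported on an arc with a further generator extends the arc at one
  of its two ends, or gives the identity. The two ends meet only when the arc is about to close up to the
  whole cycle; the bound on the number of symbols excludes this.\<close>

lemma left_comm_cyc_arc:
  assumes m: "2 \<le> m" and "is \<noteq> []" and "card ((\<lambda>i. i mod m) ` set is) < m"
  shows "left_comm seq_perms (map (cyc m) is) = \<one>\<^bsub>seq_perms\<^esub>
    \<or> (\<exists>p a. left_comm seq_perms (map (cyc m) is)
             = transvection (p mod m) ((p + length is) mod m) a
           \<and> length is < m \<and> (\<lambda>i. i mod m) ` set is = arc m p (length is))"
  using assms(2,3)
proof (induction "is" rule: rev_nonempty_induct)
  case (single i)
  have "left_comm seq_perms (map (cyc m) [i]) = transvection (i mod m) ((i + length [i]) mod m) 3"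
    by (simp add: cyc_def)
  then show ?case
    using m by (intro disjI2 exI[of _ i] exI[of _ 3]) (auto simp: arc_def)
next
  case (snoc i "is")
  let ?c = "left_comm seq_perms (map (cyc m) is)"
  let ?k = "length is"
  have card: "card (insert (i mod m) ((\<lambda>i. i mod m) ` set is)) < m"
    using snoc.prems by simp
  moreover have "card ((\<lambda>i. i mod m) ` set is) \<le> card (insert (i mod m) ((\<lambda>i. i mod m) ` set is))"
    by (rule card_mono) auto
  ultimately have IH: "?c = \<one>\<^bsub>seq_perms\<^esub> \<or> (\<exists>p a. ?c = transvection (p mod m) ((p + ?k) mod m) a
      \<and> ?k < m \<and> (\<lambda>i. i mod m) ` set is = arc m p ?k)"
    by (intro snoc.IH) (rule le_less_trans)
  have comm: "left_comm seq_perms (map (cyc m) (is @ [i])) = group_comm seq_perms ?c (cyc m i)"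
    using snoc.hyps by (simp add: left_comm_snoc)
  have i: "i mod m \<noteq> Suc i mod m"
    using m by (rule mod_neq_Suc_mod)
  from IH show ?case
  proof
    assume "?c = \<one>\<^bsub>seq_perms\<^esub>"
    then show ?thesis
      using comm group_comm_one_left[OF group_BijGroup cyc_closed[OF m]] by simp
  next
    assume "\<exists>p a. ?c = transvection (p mod m) ((p + ?k) mod m) a
      \<and> ?k < m \<and> (\<lambda>i. i mod m) ` set is = arc m p ?k"
    then obtain p a where c: "?c = transvection (p mod m) ((p + ?k) mod m) a"
      and k: "?k < m" and set_is: "(\<lambda>i. i mod m) ` set is = arc m p ?k"
      by blast
    have pk: "p mod m \<noteq> (p + ?k) mod m"
      using snoc.hyps k by (intro mod_neq_mod_add) auto
    \<comment> \<open>An extended arc still misses a generator, so its two endpoints differ.\<close>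
    have extend: "Suc ?k < m" if "insert (i mod m) (arc m p ?k) = arc m r (Suc ?k)" for r
      using card that set_is card_arc[of "Suc ?k" m r] k by simp
    consider (right) "(p + ?k) mod m = i mod m"
      | (left) "Suc i mod m = p mod m"
      | (apart) "(p + ?k) mod m \<noteq> i mod m" "Suc i mod m \<noteq> p mod m"
      by blast
    then show ?thesis
    proof cases
      case right
      have eq: "insert (i mod m) (arc m p ?k) = arc m p (Suc ?k)"
        using right by (simp add: arc_Suc_right)
      have Suc_i: "Suc i mod m = (p + Suc ?k) mod m"
        using right by (metis add_Suc_right mod_Suc_eq)
      have "p mod m \<noteq> Suc i mod m"
        unfolding Suc_i using extend[OF eq] by (intro mod_neq_mod_add) auto
      then have "group_comm seq_perms ?c (cyc m i)
          = transvection (p mod m) (Suc i mod m) (a * 3)"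
        unfolding c cyc_def right using pk i right by (intro comm_transvection_right) auto
      then show ?thesis
        using comm eq extend[OF eq] set_is Suc_i by auto
    next
      case left
      have eq: "insert (i mod m) (arc m p ?k) = arc m i (Suc ?k)"
        using arc_cong[OF left] by (simp add: arc_Suc_left)
      have end_eq: "(p + ?k) mod m = (i + Suc ?k) mod m"
        using left by (metis add_Suc add_Suc_right mod_add_left_eq)
      have "i mod m \<noteq> (p + ?k) mod m"
        unfolding end_eq using extend[OF eq] by (intro mod_neq_mod_add) auto
      then have "group_comm seq_perms ?c (cyc m i)
          = transvection (i mod m) ((p + ?k) mod m) (- (a * 3))"
        unfolding c cyc_def left using pk i left by (intro comm_transvection_left) auto
      then show ?thesis
        using comm eq extend[OF eq] set_is end_eq by auto
    next
      case apart
      then have "group_comm seq_perms ?c (cyc m i) = \<one>\<^bsub>seq_perms\<^esub>"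
        unfolding c cyc_def using pk i by (intro comm_transvection_commuting) auto
      then show ?thesis
        using comm by simp
    qed
  qed
qed

lemma left_comm_cyc_repeated:
  assumes m: "2 \<le> m" and "length is \<le> m" "card (set is) < length is"
  shows "left_comm seq_perms (map (cyc m) is) = \<one>\<^bsub>seq_perms\<^esub>"
proof -
  have le: "card ((\<lambda>i. i mod m) ` set is) < length is"
    using card_image_le[of "set is" "\<lambda>i. i mod m"] assms(3) by simp
  have "is \<noteq> []"
    using assms(3) by auto
  moreover have "(\<lambda>i. i mod m) ` set is \<noteq> arc m p (length is)" for p
    using le card_arc[OF assms(2), of p] by auto
  ultimately show ?thesis
    using left_comm_cyc_arc[OF m, of "is"] le assms(2) by auto
qed

lemma left_comm_cyc_interval:
  assumes "1 \<le> k" "k < m"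
  shows "left_comm seq_perms (map (cyc m) [1..<Suc k]) = transvection 1 (Suc k mod m) (3 ^ k)"
  using assms
proof (induction k rule: dec_induct)
  case base
  then show ?case
    by (simp add: cyc_def)
next
  case (step j)
  have "[1..<Suc (Suc j)] = [1..<Suc j] @ [Suc j]"
    using step.hyps by simp
  then have "left_comm seq_perms (map (cyc m) [1..<Suc (Suc j)])
      = group_comm seq_perms (left_comm seq_perms (map (cyc m) [1..<Suc j])) (cyc m (Suc j))"
    using step.hyps left_comm_snoc[of "map (cyc m) [1..<Suc j]" seq_perms] by simp
  also have "\<dots> = group_comm seq_perms (transvection 1 (Suc j) (3 ^ j))
      (transvection (Suc j) (Suc (Suc j) mod m) 3)"
    using step by (simp del: upt_Suc) (simp add: cyc_def)
  also have "\<dots> = transvection 1 (Suc (Suc j) mod m) (3 ^ j * 3)"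
  proof (rule comm_transvection_right)
    show "Suc j \<noteq> Suc (Suc j) mod m" "1 \<noteq> Suc (Suc j) mod m"
      using step by (auto simp: mod_Suc split: if_splits)
  qed (use step in auto)
  finally show ?case
    by (simp add: mult.commute)
qed

section \<open>The free subgroup\<close>

theorem theorem2:
  fixes n :: nat
  assumes "n \<ge> 1"
  shows "\<exists>H. subgroup H (G_group n) \<and> free_of_rank ((G_group n)\<lparr>carrier := H\<rparr>) 2"
proof -
  define m where "m = n + 2"
  have m: "2 \<le> m" "n \<le> m" "1 < m" and m3: "3 \<le> m"
    using assms by (auto simp: m_def)
  define S where "S = {1..m}"
  define \<theta> where "\<theta> = free_lift seq_perms (cyc m)"
  have cyc: "cyc m \<in> S \<rightarrow> carrier seq_perms"
    using cyc_closed m by blast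
  have \<theta>: "\<theta> \<in> hom (free_group S) seq_perms"
    unfolding \<theta>_def by (rule P.free_lift_hom[OF cyc])
  interpret \<theta>: group_hom "free_group S" seq_perms \<theta>
    using \<theta> by (simp add: group_hom_def group_hom_axioms_def group_free_group group_BijGroup)
  have gens: "set (map (free_gen S) is) \<subseteq> carrier (free_group S)" if "set is \<subseteq> S" for "is"
    using that by (auto intro!: free_gen_carrier)
  have \<theta>_gen: "\<theta> (free_gen S i) = cyc m i" if "i \<in> S" for i
    unfolding \<theta>_def by (rule P.free_lift_gen[OF cyc that])
  have \<theta>_comm: "\<theta> (left_comm (free_group S) (map (free_gen S) is))
      = left_comm seq_perms (map (cyc m) is)" if "set is \<subseteq> S" for "is"
  proof -
    have "map \<theta> (map (free_gen S) is) = map (cyc m) is"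
      using that \<theta>_gen by auto
    then show ?thesis
      using \<theta>.hom_left_comm[OF gens[OF that]] by metis
  qed
  have relators: "r \<in> carrier (free_group S) \<and> \<theta> r = \<one>\<^bsub>seq_perms\<^esub>" if "r \<in> G_relators n" for r
  proof -
    from that obtain "is" where r: "r = left_comm (free_group S) (map (free_gen S) is)"
      and i: "length is \<le> n" "set is \<subseteq> S" "card (set is) < length is"
      by (auto simp: G_relators_def S_def m_def)
    have "\<theta> r = \<one>\<^bsub>seq_perms\<^esub>"
      unfolding r \<theta>_comm[OF i(2)] using i m by (intro left_comm_cyc_repeated) auto
    then show ?thesis
      using r left_comm_closed[OF group_free_group gens[OF i(2)]] by simp
  qed
  define g where "g i = (if i = 1 then left_comm (free_group S) (map (free_gen S) [1..<m])
    else free_gen S m)" for i :: nat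
  have interval: "set [1..<m] \<subseteq> S"
    by (auto simp: S_def)
  have g: "g \<in> {1..2} \<rightarrow> carrier (free_group S)"
    using left_comm_closed[OF group_free_group gens[OF interval]]
      free_gen_carrier[of m S] m
    by (simp add: g_def S_def)
  have "\<theta> (g 1) = transvection 1 0 (3 ^ (m - 1))"
    using \<theta>_comm[OF interval] left_comm_cyc_interval[of "m - 1" m] m by (simp add: g_def)
  moreover have "\<theta> (g 2) = transvection 0 1 3"
    using \<theta>_gen[of m] m m3 by (simp add: g_def S_def cyc_def mod_Suc)
  moreover have "(3 :: int) \<le> \<bar>3 ^ (m - 1)\<bar>"
    using m self_le_power[of "3 :: int" "m - 1"] by simp
  ultimately have "\<exists>H. subgroup H (presented_group S (G_relators n))
      \<and> (presented_group S (G_relators n))\<lparr>carrier := H\<rparr> \<cong> free_group {1..2::nat}"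
    using relators
    by (intro free_subgroup_of_presented_group[OF group_BijGroup \<theta> _ _ g]
        transvections_free[where p = 1 and q = 0 and a = "3 ^ (m - 1)" and b = 3])
      auto
  then show ?thesis
    by (simp add: G_group_def free_of_rank_def S_def m_def)
qed

end
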